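(* Let $N\in\mathbb N$, $\tau\in(0,1/2)$, $\delta=\tau N$, $\lambda\ge 0$, $L=N(1+\lambda)$, $m\in\mathbb N\setminus\{1\}$, let $f\in\mathcal B_\delta(\mathbb R)$, and let $\varphi\in\Phi_{m,L}$. Let $\varepsilon>0$ and let $\tilde f_\ell=f(\ell/L)+\varepsilon_\ell$ with $|\varepsilon_\ell|\le\varepsilon$ for all $\ell\in\mathbb Z$. Then $$\|R_{\varphi,m}\tilde f-R_{\varphi,m}f\|_{C_0(\mathbb R)}\le\varepsilon\,\big(2+L\,\hat\varphi(0)\big),$$ $$\|f-R_{\varphi,m}\tilde f\|_{C_0(\mathbb R)}\le\|f-R_{\varphi,m}f\|_{C_0(\mathbb R)}+\varepsilon\,\big(2+L\,\hat\varphi(0)\big).$$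
   Context: $\mathrm{sinc}\,x=\frac{\sin x}{x}$ for $x\ne0$ and $\mathrm{sinc}\,0=1$. $\|g\|_{C_0(\mathbb R)}:=\max_{t\in\mathbb R}|g(t)|$ (read as a supremum if the maximum is not attained). Fourier transform: $\hat f(v)=\int_{\mathbb R}f(t)\,\mathrm e^{-2\pi\mathrm i tv}\,\mathrm dt$ (extended to $L^2(\mathbb R)$ by Plancherel); in particular $\hat\varphi(0)=\int_{\mathbb R}\varphi(x)\,\mathrm dx$. Paley--Wiener space: $\mathcal B_\delta(\mathbb R)=\{f\in L^2(\mathbb R):\ \mathrm{supp}\,\hat f\subseteq[-\delta,\delta]\}$; each element is identified with its smooth representative, so point values make sense. $\Phi_{m,L}$ is the set of window functions $\varphi:\mathbb R\to[0,1]$ such that: $\varphi\in L^2(\mathbb R)$ is even, positive on $(-m/L,m/L)$ and continuous on $\mathbb R\setminus\{-m/L,m/L\}$; and $\varphi|_{[0,\infty)}$ is monotonically non-increasing with $\varphi(0)=1$. The truncated window function is $\varphi_m(x)=\varphi(x)\,\mathbf 1_{[-m/L,m/L]}(x)$, where $\mathbf 1_{[-m/L,m/L]}$ is the indicator function of $[-m/L,m/L]$. The regularized Shannon sampling formula with localized sampling, with exact and with erroneous samples respectively, is $$(R_{\varphi,m}f)(t)=\sum_{\ell\in\mathbb Z}f\big(\tfrac{\ell}{L}\big)\,\mathrm{sinc}\big(L\pi(t-\tfrac{\ell}{L})\big)\,\varphi_m\big(t-\tfrac{\ell}{L}\big),\qquad (R_{\varphi,m}\tilde f)(t)=\sum_{\ell\in\mathbb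 Z}\tilde f_\ell\,\mathrm{sinc}\big(L\pi(t-\tfrac{\ell}{L})\big)\,\varphi_m\big(t-\tfrac{\ell}{L}\big),\quad t\in\mathbb R.$$ *)

theory Defs
  imports "HOL-Probability.Sinc_Integral"
begin

definition square_integrable :: "(real \<Rightarrow> 'a::{real_normed_vector, second_countable_topology}) \<Rightarrow> bool" where
  "square_integrable f \<longleftrightarrow>
     f \<in> borel_measurable lborel \<and> integrable lborel (\<lambda>t. (norm (f t))\<^sup>2)"

definition fourier_integral :: "(real \<Rightarrow> complex) \<Rightarrow> real \<Rightarrow> complex" where
  "fourier_integral f v =
     (LINT t|lborel. f t * exp (- 2 * of_real pi * \<i> * of_real t * of_real v))"

definition L2_converges :: "(nat \<Rightarrow> real \<Rightarrow> complex) \<Rightarrow> (real \<Rightarrow> complex) \<Rightarrow> bool" where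
  "L2_converges F f \<longleftrightarrow>
     (\<lambda>n. \<integral>\<^sup>+ t. ennreal ((norm (F n t - f t))\<^sup>2) \<partial>lborel) \<longlonglongrightarrow> 0"

text \<open>
  The Plancherel extension of the Fourier integral from the intersection of \<open>L\<^sup>1\<close> and \<open>L\<^sup>2\<close>
  to \<open>L\<^sup>2\<close>, written as a relation because the transform \<open>g\<close> is determined only almost
  everywhere.
\<close>

definition has_fourier_L2 :: "(real \<Rightarrow> complex) \<Rightarrow> (real \<Rightarrow> complex) \<Rightarrow> bool" where
  "has_fourier_L2 f g \<longleftrightarrow>
     square_integrable f \<and> square_integrable g \<and>
     (\<exists>F. (\<forall>n. integrable lborel (F n) \<and> square_integrable (F n)) \<and>
          L2_converges F f \<and> L2_converges (\<lambda>n. fourier_integral (F n)) g)"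

definition smooth_fun :: "(real \<Rightarrow> complex) \<Rightarrow> bool" where
  "smooth_fun f \<longleftrightarrow>
     (\<exists>D :: nat \<Rightarrow> real \<Rightarrow> complex. D 0 = f \<and>
        (\<forall>n t. (D n has_vector_derivative D (Suc n) t) (at t)))"

text \<open>
  Elements are the smooth representatives themselves, so that point values make sense; the
  support of an \<open>L\<^sup>2\<close> transform is its essential support.
\<close>

definition paley_wiener :: "real \<Rightarrow> (real \<Rightarrow> complex) set" where
  "paley_wiener \<delta> =
     {f. smooth_fun f \<and> square_integrable f \<and>
         (\<exists>g. has_fourier_L2 f g \<and> (AE v in lborel. v \<notin> {-\<delta>..\<delta>} \<longrightarrow> g v = 0))}"

definition window_class :: "nat \<Rightarrow> real \<Rightarrow> (real \<Rightarrow> real) set" where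
  "window_class m L =
     {\<phi>. range \<phi> \<subseteq> {0..1} \<and>
         square_integrable \<phi> \<and>
         (\<forall>x. \<phi> (- x) = \<phi> x) \<and>
         (\<forall>x\<in>{- real m / L<..<real m / L}. 0 < \<phi> x) \<and>
         continuous_on (UNIV - {- real m / L, real m / L}) \<phi> \<and>
         antimono_on {0..} \<phi> \<and>
         \<phi> 0 = 1}"

text \<open>
  The value \<open>\<integral>\<phi>\<close> of the Fourier transform of a nonnegative window at \<open>0\<close>. A window need not
  be integrable; the value is then \<open>\<infinity>\<close>, whereas the Bochner integral would be \<open>0\<close>.
\<close>

definition window_hat0 :: "(real \<Rightarrow> real) \<Rightarrow> ennreal" where
  "window_hat0 \<phi> = (\<integral>\<^sup>+ x. ennreal (\<phi> x) \<partial>lborel)"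

lemma window_hat0_eq_fourier_integral:
  assumes "integrable lborel \<phi>" and "\<And>x. 0 \<le> \<phi> x"
  shows "window_hat0 \<phi> < \<infinity>"
    and "fourier_integral (\<lambda>x. complex_of_real (\<phi> x)) 0 = complex_of_real (enn2real (window_hat0 \<phi>))"
proof -
  have *: "window_hat0 \<phi> = ennreal (LINT x|lborel. \<phi> x)"
    unfolding window_hat0_def using assms by (intro nn_integral_eq_integral) auto
  show "window_hat0 \<phi> < \<infinity>"
    using * by simp
  have "0 \<le> (LINT x|lborel. \<phi> x)"
    using assms(2) by (intro integral_nonneg_AE) auto
  then show "fourier_integral (\<lambda>x. complex_of_real (\<phi> x)) 0 = complex_of_real (enn2real (window_hat0 \<phi>))"
    by (simp add: * fourier_integral_def)
qed

definition truncated_window :: "nat \<Rightarrow> real \<Rightarrow> (real \<Rightarrow> real) \<Rightarrow> real \<Rightarrow> real" where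
  "truncated_window m L \<phi> x = \<phi> x * indicator {- real m / L..real m / L} x"

definition regularized_series ::
  "(real \<Rightarrow> real) \<Rightarrow> nat \<Rightarrow> real \<Rightarrow> (int \<Rightarrow> complex) \<Rightarrow> real \<Rightarrow> complex" where
  "regularized_series \<phi> m L s t =
     (\<Sum>\<^sub>\<infinity>l\<in>UNIV. s l * of_real (sinc (L * pi * (t - of_int l / L)))
                       * of_real (truncated_window m L \<phi> (t - of_int l / L)))"

definition regularized_sampling ::
  "(real \<Rightarrow> real) \<Rightarrow> nat \<Rightarrow> real \<Rightarrow> (real \<Rightarrow> complex) \<Rightarrow> real \<Rightarrow> complex" where
  "regularized_sampling \<phi> m L f = regularized_series \<phi> m L (\<lambda>l. f (of_int l / L))"

definition C0_norm :: "(real \<Rightarrow> complex) \<Rightarrow> ennreal" where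
  "C0_norm g = (SUP t. ennreal (norm (g t)))"

end

theory Submission
  imports Defs
begin

text \<open>
  The regularized series is linear in its samples, so the difference of the two reconstructions
  is the series of the sample errors. Its factors \<open>sinc\<close> are bounded by \<open>1\<close> and its errors by
  \<open>\<epsilon>\<close>, which leaves \<open>\<epsilon>\<close> times the sum of the window over the grid \<open>t - l / L\<close>. That sum is a
  Riemann sum of mesh \<open>1 / L\<close> for \<open>L \<integral>\<phi>\<close>. As \<open>\<phi>\<close> decreases away from \<open>0\<close>, each term is dominated
  by the mean of \<open>\<phi>\<close> over the grid cell that joins its grid point to the next one in the direction
  of \<open>0\<close>; only the two grid points bordering the cell that contains \<open>0\<close> lack a cell of their own,
  and they contribute at most \<open>1\<close> each (\<open>sum_even_decreasing_grid_le\<close>). The second estimate is the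
  triangle inequality.

  At each \<open>t\<close> the truncation of the window leaves finitely many nonzero terms, so every
  manipulation of the series takes place on a finite sum. Sums and suprema are compared in the
  extended nonnegative reals, where a window of infinite integral needs no separate treatment.
\<close>

lemma abs_sinc_le_1: "\<bar>sinc x\<bar> \<le> 1"
  using abs_sin_x_le_abs_x[of x] by (simp add: divide_simps)

text \<open>
  To the left and to the right of \<open>0\<close> the cells chosen for distinct grid points are disjoint, so
  the step function that takes on each cell the value of \<open>\<phi>\<close> at its outer end lies below \<open>\<phi>\<close>.
  Its integral is the sum without the two innermost terms, divided by \<open>L\<close>. Choosing the cells open
  makes their disjointness a matter of reading off the index of a cell from any of its points \<open>x\<close>
  as \<open>\<lfloor>L * (t - x)\<rfloor>\<close>.
\<close>

lemma sum_even_decreasing_grid_le: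
  fixes \<phi> :: "real \<Rightarrow> real" and L t :: real and S :: "int set"
  assumes L: "0 < L" and S: "finite S"
    and le1: "\<And>x. \<phi> x \<le> 1"
    and even: "\<And>x. \<phi> (- x) = \<phi> x" and anti: "antimono_on {0..} \<phi>"
  shows "(\<Sum>l\<in>S. ennreal (\<phi> (t - of_int l / L)))
           \<le> 2 + ennreal L * (\<integral>\<^sup>+ x. ennreal (\<phi> x) \<partial>lborel)"
proof -
  define k where "k = \<lfloor>L * t\<rfloor>"
  define a where "a l = \<phi> (t - of_int l / L)" for l :: int
  \<comment> \<open>The point \<open>t - l / L\<close> is nonnegative exactly for \<open>l \<le> k\<close>; the cell of such a point reaches
      down to \<open>t - (l + 1) / L\<close>, which is still nonnegative only for \<open>l < k\<close>. Symmetrically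
      for \<open>l > k + 1\<close>.\<close>
  define i where "i l = (if l < k then l else l - 1)" for l :: int
  define J where "J l = {t - (of_int (i l) + 1) / L <..< t - of_int (i l) / L}" for l :: int
  define T where "T = S - {k, k + 1}"
  have T: "finite T" "k \<notin> T" "k + 1 \<notin> T"
    using S by (auto simp: T_def)
  have k: "of_int k \<le> L * t" "L * t < of_int k + 1"
    unfolding k_def by linarith+
  have floor_J: "i l = \<lfloor>L * (t - x)\<rfloor>" if "x \<in> J l" for l x
    using that L by (intro floor_unique[symmetric]) (auto simp: J_def field_simps)
  have a_le: "a l \<le> \<phi> x" if l: "l \<in> T" and x: "x \<in> J l" for l x
  proof (cases "l < k")
    case True
    have "of_int l + 1 \<le> (of_int k :: real)" using True by linarith
    then have "of_int l + 1 \<le> L * t" using k by linarith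
    then have "0 < L * x" "x \<le> t - of_int l / L"
      using x L True by (auto simp: J_def i_def field_simps)
    then have "0 \<le> x" "x \<le> t - of_int l / L"
      using L by (auto simp: zero_less_mult_iff)
    then show ?thesis using monotone_onD[OF anti, of x "t - of_int l / L"] by (simp add: a_def)
  next
    case False
    then have "k + 2 \<le> l" using l T by (smt (verit))
    then have "of_int k + 2 \<le> (of_int l :: real)" by linarith
    then have "L * t \<le> of_int l - 1" using k by linarith
    then have "L * x < 0" "t - of_int l / L \<le> x"
      using x L False by (auto simp: J_def i_def field_simps)
    then have "0 \<le> - x" "- x \<le> - (t - of_int l / L)"
      using L by (auto simp: mult_less_0_iff)
    then have "\<phi> (- (t - of_int l / L)) \<le> \<phi> (- x)"
      using monotone_onD[OF anti, of "- x" "- (t - of_int l / L)"] by simp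
    then show ?thesis by (simp only: even a_def)
  qed
  have J_inj: "l = l'" if "l \<in> T" "l' \<in> T" "x \<in> J l" "x \<in> J l'" for l l' x
  proof -
    have "i l = i l'" using floor_J that by metis
    moreover have "l \<noteq> k" "l' \<noteq> k" using that T by auto
    ultimately show ?thesis by (simp add: i_def split: if_splits)
  qed
  have step_le: "(\<Sum>l\<in>T. ennreal (a l) * indicator (J l) x) \<le> ennreal (\<phi> x)" for x
  proof (cases "\<exists>l\<in>T. x \<in> J l")
    case True
    then obtain l where l: "l \<in> T" "x \<in> J l" by blast
    have "x \<notin> J l'" if "l' \<in> T - {l}" for l'
      using J_inj l that by blast
    then have "(\<Sum>l'\<in>T. ennreal (a l') * indicator (J l') x)
        = (\<Sum>l'\<in>{l}. ennreal (a l') * indicator (J l') x)"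
      using l T by (intro sum.mono_neutral_right) simp_all
    also have "\<dots> \<le> ennreal (\<phi> x)"
      using l a_le by (simp add: ennreal_leI)
    finally show ?thesis .
  next
    case False
    then have "(\<Sum>l\<in>T. ennreal (a l) * indicator (J l) x) = 0"
      by (intro sum.neutral) auto
    then show ?thesis by simp
  qed
  have J_sets: "J l \<in> sets lborel" and emeasure_J: "emeasure lborel (J l) = ennreal (1 / L)" for l
    using L by (simp_all add: J_def field_simps)
  have "(\<Sum>l\<in>T. ennreal (a l)) * ennreal (1 / L)
      = (\<Sum>l\<in>T. \<integral>\<^sup>+ x. ennreal (a l) * indicator (J l) x \<partial>lborel)"
    by (simp only: sum_distrib_right nn_integral_cmult_indicator[OF J_sets] emeasure_J)
  also have "\<dots> = (\<integral>\<^sup>+ x. (\<Sum>l\<in>T. ennreal (a l) * indicator (J l) x) \<partial>lborel)"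
    by (rule nn_integral_sum[symmetric]) (simp add: J_def)
  also have "\<dots> \<le> (\<integral>\<^sup>+ x. ennreal (\<phi> x) \<partial>lborel)"
    by (intro nn_integral_mono step_le)
  finally have "ennreal L * ((\<Sum>l\<in>T. ennreal (a l)) * ennreal (1 / L))
      \<le> ennreal L * (\<integral>\<^sup>+ x. ennreal (\<phi> x) \<partial>lborel)"
    by (rule mult_left_mono) simp
  moreover have "ennreal L * ((\<Sum>l\<in>T. ennreal (a l)) * ennreal (1 / L)) = (\<Sum>l\<in>T. ennreal (a l))"
  proof -
    have "ennreal L * ennreal (1 / L) = 1"
      using L by (simp flip: ennreal_mult)
    then show ?thesis by (metis mult.left_commute mult_1_right)
  qed
  ultimately have outer: "(\<Sum>l\<in>T. ennreal (a l)) \<le> ennreal L * (\<integral>\<^sup>+ x. ennreal (\<phi> x) \<partial>lborel)"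
    by simp
  have "(\<Sum>l\<in>S. ennreal (a l)) \<le> (\<Sum>l\<in>{k, k + 1} \<union> T. ennreal (a l))"
    using S by (intro sum_mono2) (auto simp: T_def)
  also have "\<dots> = ennreal (a k) + ennreal (a (k + 1)) + (\<Sum>l\<in>T. ennreal (a l))"
    using T by (simp add: add.assoc)
  also have "\<dots> \<le> 1 + 1 + ennreal L * (\<integral>\<^sup>+ x. ennreal (\<phi> x) \<partial>lborel)"
    using le1 by (intro add_mono outer) (auto simp: a_def)
  finally show ?thesis by (simp add: a_def)
qed

text \<open>
  The finite index set depends on the point \<open>t\<close> but not on the samples, so the series of different
  samples can be combined termwise.
\<close>

lemma regularized_series_eq_finite_sum:
  assumes "0 < L"
  obtains S where "finite S"
    "\<And>s. regularized_series \<phi> m L s t =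
      (\<Sum>l\<in>S. s l * of_real (sinc (L * pi * (t - of_int l / L)))
                 * of_real (truncated_window m L \<phi> (t - of_int l / L)))"
proof
  let ?S = "{\<lfloor>L * t - real m\<rfloor>..\<lceil>L * t + real m\<rceil>}"
  show "finite ?S" by simp
  show "regularized_series \<phi> m L s t =
      (\<Sum>l\<in>?S. s l * of_real (sinc (L * pi * (t - of_int l / L)))
                 * of_real (truncated_window m L \<phi> (t - of_int l / L)))" for s
  proof -
    have "truncated_window m L \<phi> (t - of_int l / L) = 0" if "l \<notin> ?S" for l
    proof -
      have "of_int l < L * t - real m \<or> L * t + real m < of_int l"
        using that by (auto simp: not_le) linarith+
      moreover have "t - of_int l / L = (L * t - of_int l) / L"
        using assms by (simp add: field_simps)
      ultimately have "t - of_int l / L \<notin> {- real m / L..real m / L}"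
        using assms unfolding atLeastAtMost_iff by (smt (verit) divide_le_cancel)
      then show ?thesis by (simp add: truncated_window_def)
    qed
    then show ?thesis
      unfolding regularized_series_def
      by (subst infsum_finite[symmetric], simp) (intro infsum_cong_neutral, auto)
  qed
qed

lemma regularized_series_diff:
  assumes "0 < L"
  shows "regularized_series \<phi> m L s t - regularized_series \<phi> m L s' t
       = regularized_series \<phi> m L (\<lambda>l. s l - s' l) t"
proof -
  obtain S where "\<And>s. regularized_series \<phi> m L s t =
      (\<Sum>l\<in>S. s l * of_real (sinc (L * pi * (t - of_int l / L)))
                 * of_real (truncated_window m L \<phi> (t - of_int l / L)))"
    by (rule regularized_series_eq_finite_sum[OF assms, of \<phi> m t]) blast
  then show ?thesis by (simp only: sum_subtractf[symmetric] left_diff_distrib)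
qed

lemma norm_regularized_series_le:
  assumes L: "0 < L" and \<phi>: "\<phi> \<in> window_class m L"
    and \<epsilon>: "0 \<le> \<epsilon>" and s: "\<And>l. norm (s l) \<le> \<epsilon>"
  shows "ennreal (norm (regularized_series \<phi> m L s t))
           \<le> ennreal \<epsilon> * (2 + ennreal L * window_hat0 \<phi>)"
proof -
  have \<phi>01: "0 \<le> \<phi> x" "\<phi> x \<le> 1" for x
    using \<phi> by (auto simp: window_class_def image_subset_iff)
  obtain S where S: "finite S" and eq: "\<And>s. regularized_series \<phi> m L s t =
      (\<Sum>l\<in>S. s l * of_real (sinc (L * pi * (t - of_int l / L)))
                 * of_real (truncated_window m L \<phi> (t - of_int l / L)))"
    by (rule regularized_series_eq_finite_sum[OF L, of \<phi> m t]) blast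
  have "norm (regularized_series \<phi> m L s t) \<le> (\<Sum>l\<in>S. \<epsilon> * \<phi> (t - of_int l / L))"
    unfolding eq
  proof (rule sum_norm_le)
    fix l
    let ?x = "t - of_int l / L"
    have "norm (s l) * \<bar>sinc (L * pi * ?x)\<bar> * \<bar>truncated_window m L \<phi> ?x\<bar> \<le> \<epsilon> * 1 * \<phi> ?x"
      using \<epsilon> \<phi>01[of ?x]
      by (intro mult_mono s abs_sinc_le_1) (simp_all add: truncated_window_def indicator_def)
    then show "norm (s l * of_real (sinc (L * pi * ?x)) * of_real (truncated_window m L \<phi> ?x))
        \<le> \<epsilon> * \<phi> ?x"
      by (simp only: norm_mult norm_of_real mult_1_right)
  qed
  then have "ennreal (norm (regularized_series \<phi> m L s t))
      \<le> ennreal \<epsilon> * (\<Sum>l\<in>S. ennreal (\<phi> (t - of_int l / L)))"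
    using \<epsilon> \<phi>01 by (simp add: sum_ennreal sum_nonneg ennreal_leI sum_distrib_left flip: ennreal_mult)
  also have "\<dots> \<le> ennreal \<epsilon> * (2 + ennreal L * window_hat0 \<phi>)"
    unfolding window_hat0_def using L S \<phi>01 \<phi>
    by (intro mult_left_mono sum_even_decreasing_grid_le) (auto simp: window_class_def)
  finally show ?thesis .
qed

lemma C0_norm_diff_le:
  "C0_norm (\<lambda>t. f t - h t) \<le> C0_norm (\<lambda>t. f t - g t) + C0_norm (\<lambda>t. h t - g t)"
  unfolding C0_norm_def
proof (rule SUP_least)
  fix t
  have "norm (f t - h t) \<le> norm (f t - g t) + norm (h t - g t)"
    using norm_triangle_ineq4[of "f t - g t" "h t - g t"] by simp
  then have "ennreal (norm (f t - h t)) \<le> ennreal (norm (f t - g t)) + ennreal (norm (h t - g t))"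
    by (simp add: ennreal_leI flip: ennreal_plus)
  also have "\<dots> \<le> (SUP t. ennreal (norm (f t - g t))) + (SUP t. ennreal (norm (h t - g t)))"
    by (intro add_mono SUP_upper) auto
  finally show "ennreal (norm (f t - h t))
      \<le> (SUP t. ennreal (norm (f t - g t))) + (SUP t. ennreal (norm (h t - g t)))" .
qed

theorem theorem3p4:
  fixes N m :: nat and \<tau> \<delta> lam L \<epsilon> :: real
    and f :: "real \<Rightarrow> complex" and \<phi> :: "real \<Rightarrow> real"
    and err fs :: "int \<Rightarrow> complex"
  assumes "N \<ge> 1"
    and "0 < \<tau>" and "\<tau> < 1 / 2"
    and "\<delta> = \<tau> * real N"
    and "lam \<ge> 0"
    and "L = real N * (1 + lam)"
    and "m \<ge> 2"
    and "f \<in> paley_wiener \<delta>"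
    and "\<phi> \<in> window_class m L"
    and "\<epsilon> > 0"
    and "\<And>l. fs l = f (of_int l / L) + err l"
    and "\<And>l. norm (err l) \<le> \<epsilon>"
  shows "C0_norm (\<lambda>t. regularized_series \<phi> m L fs t - regularized_sampling \<phi> m L f t)
           \<le> ennreal \<epsilon> * (2 + ennreal L * window_hat0 \<phi>)
       \<and> C0_norm (\<lambda>t. f t - regularized_series \<phi> m L fs t)
           \<le> C0_norm (\<lambda>t. f t - regularized_sampling \<phi> m L f t)
             + ennreal \<epsilon> * (2 + ennreal L * window_hat0 \<phi>)"
proof
  have L: "0 < L" using assms(1,5,6) by simp
  have diff: "regularized_series \<phi> m L fs t - regularized_sampling \<phi> m L f t
      = regularized_series \<phi> m L err t" for t
    unfolding regularized_sampling_def regularized_series_diff[OF L] using assms(11) by simp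
  show error: "C0_norm (\<lambda>t. regularized_series \<phi> m L fs t - regularized_sampling \<phi> m L f t)
      \<le> ennreal \<epsilon> * (2 + ennreal L * window_hat0 \<phi>)"
    unfolding C0_norm_def diff using L assms(9,10,12)
    by (intro SUP_least norm_regularized_series_le) auto
  show "C0_norm (\<lambda>t. f t - regularized_series \<phi> m L fs t)
      \<le> C0_norm (\<lambda>t. f t - regularized_sampling \<phi> m L f t)
        + ennreal \<epsilon> * (2 + ennreal L * window_hat0 \<phi>)"
    by (rule order_trans[OF C0_norm_diff_le add_left_mono[OF error]])
qed

end
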